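(* Let $n\ge 1$, let $R=\mathbb{H}[x_1,\dots,x_n]$, and let $I$ be a left ideal of $R$. If $v\in\mathcal{V}(I)$, then $B(v)\subseteq\mathcal{V}(I)$, where $B(v)$ is the enveloping multisphere of $v$.
   Context: $\mathbb{H}$ is Hamilton's algebra of real quaternions. $R=\mathbb{H}[x_1,\dots,x_n]$ is the ring of polynomials in $n$ central variables: the variables commute with each other and with all coefficients. For $f=\sum a_{i_1,\dots,i_n}x_1^{i_1}\cdots x_n^{i_n}\in R$ (coefficients on the left) and any $a=(a_1,\dots,a_n)\in\mathbb{H}^n$, define $f(a)=\sum a_{i_1,\dots,i_n}a_1^{i_1}\cdots a_n^{i_n}$ (products in this order). For $I\subseteq R$, $\mathcal{V}(I)=\{a\in\mathbb{H}^n : f(a)=0 \text{ for all } f\in I\}$. For $m\ge1$, $\mathbb{H}^m_c=\{(q_1,\dots,q_m)\in\mathbb{H}^m : q_iq_j=q_jq_i \text{ for all } i,j\}$. For $w=(q_1,\dots,q_m)\in\mathbb{H}^m$, $\mathbb{S}_w=\{(qq_1q^{-1},\dots,qq_mq^{-1}) : q\in\mathbb{H}\setminus\{0\}\}$. Central presentation: every $v\in\mathbb{H}^n$ can be written uniquely as a concatenation $v=(v_0,\dots,v_r)$ with $r\ge 0$, $v_i=(v_{i,1},\dots,v_{i,k_i})\in\mathbb{H}^{k_i}_c$, $k_i\ge1$, $\sum_{i=0}^r k_i=n$, such that $(v_{i,k_i},v_{i+1})\notin\mathbb{H}^{k_{i+1}+1}_c$ for all $0\le i\le r-1$. The enveloping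 multisphere of $v$ is $B(v)=\{v_0\}\times\mathbb{S}_{v_1}\times\cdots\times\mathbb{S}_{v_r}\subseteq\mathbb{H}^n$. *)

theory Defs
  imports Complex_Main "HOL-Library.Poly_Mapping"
begin

section \<open>Hamilton's quaternions\<close>

text \<open>\<open>Quat a b c d\<close> is $a + b i + c j + d k$.\<close>

datatype quat = Quat (q1: real) (qi: real) (qj: real) (qk: real)

lemma quat_eq_iff: "x = y \<longleftrightarrow> q1 x = q1 y \<and> qi x = qi y \<and> qj x = qj y \<and> qk x = qk y"
  by (cases x; cases y) simp

instantiation quat :: ring_1
begin

definition "0 = Quat 0 0 0 0"
definition "1 = Quat 1 0 0 0"
definition "x + y = Quat (q1 x + q1 y) (qi x + qi y) (qj x + qj y) (qk x + qk y)"
definition "- x = Quat (- q1 x) (- qi x) (- qj x) (- qk x)"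
definition "x - y = Quat (q1 x - q1 y) (qi x - qi y) (qj x - qj y) (qk x - qk y)"
definition "x * y = Quat
  (q1 x * q1 y - qi x * qi y - qj x * qj y - qk x * qk y)
  (q1 x * qi y + qi x * q1 y + qj x * qk y - qk x * qj y)
  (q1 x * qj y - qi x * qk y + qj x * q1 y + qk x * qi y)
  (q1 x * qk y + qi x * qj y - qj x * qi y + qk x * q1 y)"

instance
  by intro_classes
     (simp_all add: quat_eq_iff zero_quat_def one_quat_def plus_quat_def uminus_quat_def
        minus_quat_def times_quat_def algebra_simps)

end

definition quat_normsq :: "quat \<Rightarrow> real" where
  "quat_normsq x = (q1 x)\<^sup>2 + (qi x)\<^sup>2 + (qj x)\<^sup>2 + (qk x)\<^sup>2"

lemma quat_normsq_eq_0_iff: "quat_normsq x = 0 \<longleftrightarrow> x = 0"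
  unfolding quat_normsq_def quat_eq_iff zero_quat_def
  by (auto simp: add_nonneg_eq_0_iff)

instantiation quat :: division_ring
begin

definition "inverse x = Quat (q1 x / quat_normsq x) (- qi x / quat_normsq x)
  (- qj x / quat_normsq x) (- qk x / quat_normsq x)"
definition "x div (y :: quat) = x * inverse y"

instance
proof
  fix x y :: quat
  show "inverse x * x = 1" if "x \<noteq> 0"
  proof -
    have "quat_normsq x \<noteq> 0" using that by (simp add: quat_normsq_eq_0_iff)
    then show ?thesis
      by (simp add: quat_eq_iff one_quat_def inverse_quat_def times_quat_def divide_simps)
         (simp add: quat_normsq_def power2_eq_square)
  qed
  show "x * inverse x = 1" if "x \<noteq> 0"
  proof -
    have "quat_normsq x \<noteq> 0" using that by (simp add: quat_normsq_eq_0_iff)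
    then show ?thesis
      by (simp add: quat_eq_iff one_quat_def inverse_quat_def times_quat_def divide_simps)
         (simp add: quat_normsq_def power2_eq_square)
  qed
  show "x div y = x * inverse y" by (simp add: divide_quat_def)
  show "inverse (0 :: quat) = 0"
    by (simp add: inverse_quat_def zero_quat_def)
qed

end


section \<open>Polynomials in central variables, evaluation, zero loci\<close>

text \<open>
  A monomial $x_1^{m_1} \cdots x_n^{m_n}$ is its finitely supported exponent function, with
  the variables numbered from $0$ to $n - 1$. The multiplication of the type
  \<open>quat_mpoly\<close> is the convolution product, so the variables are central.
\<close>

type_synonym quat_mpoly = "(nat \<Rightarrow>\<^sub>0 nat) \<Rightarrow>\<^sub>0 quat"

definition polys :: "nat \<Rightarrow> quat_mpoly set" where
  "polys n = {f. \<forall>m \<in> Poly_Mapping.keys f. Poly_Mapping.keys m \<subseteq> {..<n}}"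

definition left_ideal :: "nat \<Rightarrow> quat_mpoly set \<Rightarrow> bool" where
  "left_ideal n I \<longleftrightarrow> I \<subseteq> polys n \<and> 0 \<in> I \<and> (\<forall>f\<in>I. \<forall>g\<in>I. f + g \<in> I)
     \<and> (\<forall>r\<in>polys n. \<forall>f\<in>I. r * f \<in> I)"

text \<open>
  Points of $\mathbb{H}^n$ are lists of length \<open>n\<close>. The coefficient stands on the left and
  \<open>prod_list\<close> multiplies the powers of the coordinates in the order of their indices.
\<close>

definition eval_poly :: "quat list \<Rightarrow> quat_mpoly \<Rightarrow> quat" where
  "eval_poly a f = (\<Sum>m \<in> Poly_Mapping.keys f. Poly_Mapping.lookup f m *
     prod_list (map (\<lambda>i. (a ! i) ^ Poly_Mapping.lookup m i) [0..<length a]))"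

definition zero_locus :: "nat \<Rightarrow> quat_mpoly set \<Rightarrow> quat list set" where
  "zero_locus n I = {a. length a = n \<and> (\<forall>f\<in>I. eval_poly a f = 0)}"


section \<open>Central presentations and enveloping multispheres\<close>

definition commuting :: "quat list \<Rightarrow> bool" where
  "commuting w \<longleftrightarrow> (\<forall>p\<in>set w. \<forall>q\<in>set w. p * q = q * p)"

definition conj_sphere :: "quat list \<Rightarrow> quat list set" where
  "conj_sphere w = {map (\<lambda>p. q * p * inverse q) w |q. q \<noteq> 0}"

definition central_presentation :: "quat list \<Rightarrow> quat list list \<Rightarrow> bool" where
  "central_presentation v vs \<longleftrightarrow> vs \<noteq> [] \<and> concat vs = v
     \<and> (\<forall>w\<in>set vs. w \<noteq> [] \<and> commuting w)
     \<and> (\<forall>i. Suc i < length vs \<longrightarrow> \<not> commuting (last (vs ! i) # vs ! Suc i))"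

lemma commuting_singleton [simp]: "commuting [x]"
  by (simp add: commuting_def)

lemma central_presentation_Cons_Cons:
  "central_presentation v (w # w' # vs) \<longleftrightarrow> w \<noteq> [] \<and> commuting w
     \<and> \<not> commuting (last w # w') \<and> (\<exists>v'. v = w @ v' \<and> central_presentation v' (w' # vs))"
  unfolding central_presentation_def by (auto simp: nth_Cons split: nat.splits)

lemma central_presentation_single:
  "central_presentation v [w] \<longleftrightarrow> v = w \<and> w \<noteq> [] \<and> commuting w"
  unfolding central_presentation_def by auto

lemma central_presentation_ex1:
  assumes "v \<noteq> []"
  shows "\<exists>!vs. central_presentation v vs"
  using assms
proof (induction v)
  case Nil
  then show ?case by simp
next
  case (Cons x v)
  show ?case
  proof (cases "v = []")
    case True
    show ?thesis
    proof
      show "central_presentation (x # v) [[x]]"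
        using True by (simp add: central_presentation_single)
      fix vs
      assume *: "central_presentation (x # v) vs"
      then obtain w ws where vs: "vs = w # ws"
        by (cases vs) (auto simp: central_presentation_def)
      have "w \<noteq> []" "w @ concat ws = [x]" "\<forall>w\<in>set ws. w \<noteq> []"
        using * True vs by (auto simp: central_presentation_def)
      then show "vs = [[x]]"
        unfolding vs by (cases ws) (auto simp: append_eq_Cons_conv)
    qed
  next
    case False
    then obtain us where us: "central_presentation v us"
      and uniq: "\<And>ws. central_presentation v ws \<Longrightarrow> ws = us"
      using Cons.IH by blast
    obtain u us' where us_eq: "us = u # us'"
      using us by (cases us) (auto simp: central_presentation_def)
    have "u \<noteq> []" using us us_eq by (simp add: central_presentation_def)
    have ex: "central_presentation (x # v)
        (if commuting (x # u) then (x # u) # us' else [x] # us)"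
      using us \<open>u \<noteq> []\<close> unfolding us_eq
      by (cases us') (auto simp: central_presentation_Cons_Cons central_presentation_single)
    have un: "ws = (if commuting (x # u) then (x # u) # us' else [x] # us)"
      if ws: "central_presentation (x # v) ws" for ws
    proof -
      obtain w ws' where ws_eq: "ws = w # ws'"
        using ws by (cases ws) (auto simp: central_presentation_def)
      have "w \<noteq> []" and cw: "commuting w" and cc: "w @ concat ws' = x # v"
        using ws ws_eq by (simp_all add: central_presentation_def)
      then obtain w' where w: "w = x # w'" and v: "v = w' @ concat ws'"
        by (cases w) auto
      show ?thesis
      proof (cases "w' = []")
        case True
        then obtain z zs where zs: "ws' = z # zs"
          using v False by (cases ws') auto
        have "central_presentation v ws'" and nc: "\<not> commuting (x # z)"
          using ws unfolding ws_eq w True zs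
          by (auto simp: central_presentation_Cons_Cons)
        then have "ws' = us" by (intro uniq)
        with nc zs us_eq show ?thesis by (simp add: ws_eq w True)
      next
        case w': False
        have "commuting w'" using cw unfolding w commuting_def by auto
        then have "central_presentation v (w' # ws')"
          using ws w' unfolding ws_eq w
          by (cases ws') (auto simp: central_presentation_Cons_Cons central_presentation_single)
        then have "w' # ws' = us" by (rule uniq)
        with cw us_eq show ?thesis by (simp add: ws_eq w)
      qed
    qed
    show ?thesis using ex un by blast
  qed
qed

definition the_central_presentation :: "quat list \<Rightarrow> quat list list" where
  "the_central_presentation v = (THE vs. central_presentation v vs)"

text \<open>The first block is kept fixed; each later block ranges over its own conjugacy sphere.\<close>

definition enveloping_multisphere :: "quat list \<Rightarrow> quat list set" where
  "enveloping_multisphere v = {hd vs @ concat ws |vs ws. vs = the_central_presentation v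
     \<and> list_all2 (\<lambda>w u. w \<in> conj_sphere u) ws (tl vs)}"

end

theory Submission
  imports Defs
begin

text \<open>
  Let a zero of \<open>I\<close> be written \<open>u @ w @ s\<close>, where \<open>w\<close> is a commuting block containing an entry
  \<open>x\<close> that does not commute with \<open>p = last u\<close>. For \<open>f\<close> with coefficients $c_m$, insert a
  quaternion $t$ between the factors of the monomials that come from \<open>u\<close> and those that come from
  \<open>w @ s\<close>, and let $F_f(t) = \sum_m c_m\, u^m\, t\, (w,s)^m$.

  Multiplying \<open>f\<close> by the variable belonging to \<open>p\<close> inserts a factor \<open>p\<close> at the right end of $u^m$,
  and multiplying it by the variable belonging to \<open>x\<close> inserts a factor \<open>x\<close> into $w^m$, which can be
  moved to the left end because \<open>w\<close> commutes. As \<open>I\<close> is a left ideal, $F_f$ therefore vanishes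
  at $1$, $p$, $x$ and $px$ for every \<open>f\<close> in \<open>I\<close>. Two noncommuting quaternions $p$, $x$ make
  $1, p, x, px$ a real basis of $\mathbb{H}$ (\<open>noncommuting_span\<close>), and $F_f$ is real linear, so
  $F_f(q) = 0$ for every $q$. But $q\,(w,s)^m = (q w q^{-1}, q s q^{-1})^m\, q$, so for $q \neq 0$ the
  point $(u, q w q^{-1}, q s q^{-1})$ is again a zero of \<open>I\<close> (\<open>zero_locus_conj_tail\<close>).

  One such step turns all of \<open>w @ s\<close>, not just \<open>w\<close>. To move the blocks independently, the later
  blocks are first brought into the position that the step for \<open>w\<close> will carry to the prescribed one.
  Working from the last block to the first, each step finds its own block and everything before it
  unmoved, so the central presentation supplies the commutation hypotheses
  (\<open>zero_locus_conj_blocks\<close>).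
\<close>

section \<open>Noncommuting quaternions and the real span of their products\<close>

definition qreal :: "real \<Rightarrow> quat" where
  "qreal r = Quat r 0 0 0"

lemma qreal_commute: "qreal r * x = x * qreal r"
  by (simp add: qreal_def times_quat_def)

text \<open>
  With $P$, $X$ the imaginary parts, $p$ and $x$ commute exactly when the cross product
  $P \times X$ vanishes; otherwise $P$, $X$, $P \times X$ is a basis of the imaginary quaternions,
  and $P \times X$ differs from $px$ by a combination of $1$, $P$ and $X$. The coefficients come from
  Cramer's rule.
\<close>

lemma noncommuting_span:
  fixes p x q :: quat
  assumes "p * x \<noteq> x * p"
  obtains a b c d where "q = qreal a + qreal b * p + qreal c * x + qreal d * (p * x)"
proof -
  define P1 P2 P3 X1 X2 X3 Q1 Q2 Q3
    where "P1 = qi p" and "P2 = qj p" and "P3 = qk p"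
      and "X1 = qi x" and "X2 = qj x" and "X3 = qk x"
      and "Q1 = qi q" and "Q2 = qj q" and "Q3 = qk q"
  note vars = P1_def P2_def P3_def X1_def X2_def X3_def Q1_def Q2_def Q3_def
  define C1 C2 C3 where "C1 = P2 * X3 - P3 * X2" and "C2 = P3 * X1 - P1 * X3"
    and "C3 = P1 * X2 - P2 * X1"
  define N where "N = C1\<^sup>2 + C2\<^sup>2 + C3\<^sup>2"
  have "C1 \<noteq> 0 \<or> C2 \<noteq> 0 \<or> C3 \<noteq> 0"
    using assms by (auto simp: quat_eq_iff times_quat_def C1_def C2_def C3_def vars algebra_simps)
  then have N: "N \<noteq> 0"
    unfolding N_def by (auto simp: add_nonneg_eq_0_iff)
  define A B D where
    "A = (Q2 * X3 - Q3 * X2) * C1 + (Q3 * X1 - Q1 * X3) * C2 + (Q1 * X2 - Q2 * X1) * C3"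
    and "B = (P2 * Q3 - P3 * Q2) * C1 + (P3 * Q1 - P1 * Q3) * C2 + (P1 * Q2 - P2 * Q1) * C3"
    and "D = Q1 * C1 + Q2 * C2 + Q3 * C3"
  note defs = N_def A_def B_def D_def C1_def C2_def C3_def
  have "N * Q1 = A * P1 + B * X1 + D * C1" unfolding defs by algebra
  moreover have "N * Q2 = A * P2 + B * X2 + D * C2" unfolding defs by algebra
  moreover have "N * Q3 = A * P3 + B * X3 + D * C3" unfolding defs by algebra
  moreover define \<alpha> \<beta> \<gamma> where "\<alpha> = A / N" and "\<beta> = B / N" and "\<gamma> = D / N"
  moreover have "y = A / N * r + B / N * s + D / N * t" if "N * y = A * r + B * s + D * t" for y r s t
    using N that by (simp add: nonzero_eq_divide_eq mult.commute flip: add_divide_distrib)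
  ultimately have Q: "Q1 = \<alpha> * P1 + \<beta> * X1 + \<gamma> * C1" "Q2 = \<alpha> * P2 + \<beta> * X2 + \<gamma> * C2"
    "Q3 = \<alpha> * P3 + \<beta> * X3 + \<gamma> * C3"
    by (simp_all only:)
  define b c where "b = \<alpha> - \<gamma> * q1 x" and "c = \<beta> - \<gamma> * q1 p"
  define a where "a = q1 q - b * q1 p - c * q1 x - \<gamma> * q1 (p * x)"
  have "q = qreal a + qreal b * p + qreal c * x + qreal \<gamma> * (p * x)"
    using Q
    by (simp add: quat_eq_iff qreal_def times_quat_def plus_quat_def a_def b_def c_def
        C1_def C2_def C3_def vars algebra_simps)
  then show ?thesis by (rule that)
qed

section \<open>Values of monomials\<close>

text \<open>
  The first coordinate of the list belongs to the variable number \<open>k\<close>, so that a tail of a point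
  can be evaluated on its own.
\<close>

primrec monom_value :: "nat \<Rightarrow> quat list \<Rightarrow> (nat \<Rightarrow>\<^sub>0 nat) \<Rightarrow> quat" where
  "monom_value k [] m = 1"
| "monom_value k (x # xs) m = x ^ Poly_Mapping.lookup m k * monom_value (Suc k) xs m"

abbreviation var_exp :: "nat \<Rightarrow> (nat \<Rightarrow>\<^sub>0 nat)" where
  "var_exp j \<equiv> Poly_Mapping.single j 1"

lemma monom_value_eq_prod_list:
  "monom_value k xs m
     = prod_list (map (\<lambda>i. (xs ! i) ^ Poly_Mapping.lookup m (k + i)) [0..<length xs])"
proof (induction xs arbitrary: k)
  case (Cons x xs)
  have "[0..<length (x # xs)] = 0 # map Suc [0..<length xs]"
    by (simp add: map_Suc_upt upt_conv_Cons del: upt_Suc)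
  then show ?case by (simp add: Cons.IH o_def del: upt_Suc)
qed simp

lemma monom_value_append:
  "monom_value k (xs @ ys) m = monom_value k xs m * monom_value (k + length xs) ys m"
  by (induction xs arbitrary: k) (simp_all add: mult.assoc)

lemma monom_value_var_outside:
  assumes "j < k \<or> k + length xs \<le> j"
  shows "monom_value k xs (Poly_Mapping.single j c + m) = monom_value k xs m"
  using assms by (induction xs arbitrary: k) (auto simp: lookup_add lookup_single when_def)

lemma monom_value_var_last:
  "monom_value k (xs @ [p]) (var_exp (k + length xs) + m) = monom_value k (xs @ [p]) m * p"
  by (simp add: monom_value_append monom_value_var_outside lookup_add
      mult.assoc power_Suc2[symmetric] del: power_Suc)

text \<open>
  The new factor \<open>x\<close> appears next to the power of \<open>x\<close> already present and is moved to the front past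
  the entries before it.
\<close>

lemma monom_value_var_front:
  assumes "\<And>y. y \<in> set xs \<Longrightarrow> x * y = y * x"
  shows "monom_value k (xs @ x # ys) (var_exp (k + length xs) + m)
           = x * monom_value k (xs @ x # ys) m"
  using assms
proof (induction xs arbitrary: k)
  case Nil
  show ?case by (simp add: monom_value_var_outside lookup_add mult.assoc)
next
  case (Cons y xs)
  have IH: "monom_value (Suc k) (xs @ x # ys) (var_exp (k + length (y # xs)) + m)
      = x * monom_value (Suc k) (xs @ x # ys) m"
    using Cons.IH[of "Suc k"] Cons.prems by simp
  have "y ^ i * x = x * y ^ i" for i
    using Cons.prems[of y] by (intro power_commuting_commutes) simp
  then show ?case
    unfolding append_Cons monom_value.simps IH
    by (simp add: lookup_add lookup_single when_def mult.assoc[symmetric])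
qed

lemma conj_power:
  fixes q x :: "'a :: division_ring"
  assumes "q \<noteq> 0"
  shows "(q * x * inverse q) ^ n * q = q * x ^ n"
proof (induction n)
  case (Suc n)
  have "(q * x * inverse q) ^ Suc n * q = q * x * inverse q * (q * x ^ n)"
    by (simp only: power_Suc mult.assoc[of _ _ q] Suc.IH)
  also have "\<dots> = q * x * (inverse q * q) * x ^ n"
    by (simp only: mult.assoc)
  finally show ?case using assms by (simp add: mult.assoc)
qed simp

text \<open>
  In this form, with \<open>q\<close> moving from one side to the other, the conjugations of adjacent powers cancel
  by induction along the list.
\<close>

lemma monom_value_conj:
  assumes "q \<noteq> 0"
  shows "monom_value k (map (\<lambda>x. q * x * inverse q) xs) m * q = q * monom_value k xs m"
proof (induction xs arbitrary: k)
  case (Cons x xs)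
  show ?case
    by (simp only: list.map monom_value.simps mult.assoc[of _ _ q] Cons.IH)
       (simp only: mult.assoc[symmetric] conj_power[OF assms])
qed simp

section \<open>Left linear functionals on polynomials\<close>

text \<open>
  The left linear extension of \<open>g\<close> from monomials to polynomials. Evaluation is the case where \<open>g\<close>
  is the value of monomials at a point; an arbitrary \<open>g\<close> allows an additional factor
  inside these values.
\<close>

definition lin_ext :: "((nat \<Rightarrow>\<^sub>0 nat) \<Rightarrow> quat) \<Rightarrow> quat_mpoly \<Rightarrow> quat" where
  "lin_ext g f = (\<Sum>m \<in> Poly_Mapping.keys f. Poly_Mapping.lookup f m * g m)"

lemma eval_poly_eq_lin_ext: "eval_poly a f = lin_ext (monom_value 0 a) f"
  by (simp add: eval_poly_def lin_ext_def monom_value_eq_prod_list)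

lemma lin_ext_add: "lin_ext g (f + f') = lin_ext g f + lin_ext g f'"
  unfolding lin_ext_def by (rule setsum_keys_plus_distrib) (simp_all add: distrib_right)

lemma lin_ext_single: "lin_ext g (Poly_Mapping.single m c) = c * g m"
  by (simp add: lin_ext_def)

text \<open>
  The reason for passing to functionals: multiplying the polynomial by a monomial amounts to
  shifting the argument of \<open>g\<close>, whatever \<open>g\<close> does with the noncommuting coordinates.
\<close>

lemma lin_ext_var_times:
  "lin_ext g (Poly_Mapping.single e 1 * f) = lin_ext (\<lambda>m. g (e + m)) f"
proof (induction f rule: update_induct)
  case const
  show ?case by (simp add: lin_ext_def)
next
  case (update f m c)
  have "Poly_Mapping.update m c f = f + Poly_Mapping.single m c"
    using update.hyps(1)
    by (intro poly_mapping_eqI) (auto simp: lookup_update lookup_add lookup_single in_keys_iff when_def)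
  then show ?case
    by (simp add: update.IH distrib_left mult_single lin_ext_add lin_ext_single)
qed

lemma var_times_mem_left_ideal:
  assumes "left_ideal n I" "f \<in> I" "j < n"
  shows "Poly_Mapping.single (var_exp j) 1 * f \<in> I"
  using assms unfolding left_ideal_def polys_def by (auto split: if_splits)

section \<open>Turning the tail of a zero\<close>

text \<open>
  The rest \<open>s\<close> is arbitrary, and it must be turned along with \<open>w\<close>: the inserted \<open>q\<close> can be removed
  only at the right end of the monomial values, after passing every remaining coordinate.
\<close>

lemma zero_locus_conj_tail:
  assumes I: "left_ideal n I" and zero: "u @ w @ s \<in> zero_locus n I"
    and "u \<noteq> []" and w: "commuting w" and nc: "\<not> commuting (last u # w)" and "q \<noteq> 0"
  shows "u @ map (\<lambda>x. q * x * inverse q) (w @ s) \<in> zero_locus n I"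
proof -
  obtain u' p where u: "u = u' @ [p]"
    using \<open>u \<noteq> []\<close> by (cases u rule: rev_cases) auto
  obtain x where "x \<in> set w" and px: "p * x \<noteq> x * p"
    using nc w unfolding u commuting_def by simp metis
  then obtain w1 w2 where w_split: "w = w1 @ x # w2"
    by (auto simp: in_set_conv_decomp)
  define k j where "k = length u'" and "j = length u + length w1"
  have "k < n" "j < n"
    using zero by (auto simp: zero_locus_def u w_split k_def j_def)
  define U T where "U = monom_value 0 u" and "T = monom_value (length u) (w @ s)"
  have Uk: "U (var_exp k + m) = U m * p" and Uj: "U (var_exp j + m) = U m"
    and Tk: "T (var_exp k + m) = T m" for m
    using monom_value_var_last[of 0 u' p m]
    by (simp_all add: U_def T_def u k_def j_def monom_value_var_outside)
  have Tj: "T (var_exp j + m) = x * T m" for m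
  proof -
    have "x * y = y * x" if "y \<in> set w1" for y
    proof -
      have "y \<in> set w" using that by (simp add: w_split)
      with w \<open>x \<in> set w\<close> show ?thesis unfolding commuting_def by blast
    qed
    from monom_value_var_front[OF this, where k = "length u" and ys = "w2 @ s"]
    show ?thesis by (simp add: T_def w_split j_def)
  qed
  \<comment> \<open>The evaluation of \<open>f\<close> with the factor \<open>t\<close> inserted between \<open>u\<close> and \<open>w @ s\<close>.\<close>
  define F where "F f t = lin_ext (\<lambda>m. U m * t * T m) f" for f t
  have F_add: "F f (t + t') = F f t + F f t'" for f t t'
    by (simp add: F_def lin_ext_def distrib_left distrib_right sum.distrib)
  have F_real: "F f (qreal r * t) = qreal r * F f t" for f r t
  proof -
    have "c * (d * (qreal r * t) * e) = qreal r * (c * (d * t * e))" for c d e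
      by (metis qreal_commute mult.assoc)
    then show ?thesis by (simp add: F_def lin_ext_def sum_distrib_left)
  qed
  have F_k: "F (Poly_Mapping.single (var_exp k) 1 * f) t = F f (p * t)" for f t
    by (simp only: F_def lin_ext_var_times Uk Tk mult.assoc)
  have F_j: "F (Poly_Mapping.single (var_exp j) 1 * f) t = F f (t * x)" for f t
    by (simp only: F_def lin_ext_var_times Uj Tj mult.assoc)
  have F_1: "F f 1 = 0" if "f \<in> I" for f
    using zero that
    by (simp add: zero_locus_def eval_poly_eq_lin_ext F_def lin_ext_def monom_value_append
        U_def T_def mult.assoc)
  have F_p: "F f p = 0" if "f \<in> I" for f
    using F_1[OF var_times_mem_left_ideal[OF I that \<open>k < n\<close>]] unfolding F_k mult_1_right .
  have F_x: "F f x = 0" if "f \<in> I" for f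
    using F_1[OF var_times_mem_left_ideal[OF I that \<open>j < n\<close>]] unfolding F_j mult_1_left .
  have F_px: "F f (p * x) = 0" if "f \<in> I" for f
    using F_x[OF var_times_mem_left_ideal[OF I that \<open>k < n\<close>]] unfolding F_k .
  have "eval_poly (u @ map (\<lambda>x. q * x * inverse q) (w @ s)) f = 0" if "f \<in> I" for f
  proof -
    obtain a b c d where q: "q = qreal a + qreal b * p + qreal c * x + qreal d * (p * x)"
      by (rule noncommuting_span[OF px])
    have "F f (qreal a * 1 + qreal b * p + qreal c * x + qreal d * (p * x)) = 0"
      unfolding F_add F_real using F_1 F_p F_x F_px that by simp
    then have "F f q = 0" unfolding q mult_1_right .
    moreover have "F f q = eval_poly (u @ map (\<lambda>x. q * x * inverse q) (w @ s)) f * q"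
      unfolding F_def eval_poly_eq_lin_ext lin_ext_def sum_distrib_right U_def T_def
        monom_value_append[of _ u]
      by (simp only: mult.assoc[of _ q] mult.assoc[of _ _ q] monom_value_conj[OF \<open>q \<noteq> 0\<close>] add_0)
    ultimately show ?thesis using \<open>q \<noteq> 0\<close> by simp
  qed
  then show ?thesis using zero by (simp add: zero_locus_def)
qed

section \<open>Moving the blocks independently\<close>

lemma map_conj_inverse_conj:
  fixes q :: "'a :: division_ring"
  assumes "q \<noteq> 0"
  shows "map (\<lambda>x. q * x * inverse q) (map (\<lambda>x. inverse q * x * q) xs) = xs"
  using assms by (simp add: o_def mult.assoc) (simp add: mult.assoc[symmetric])

lemma conj_sphere_closed:
  assumes "w \<in> conj_sphere u" "q \<noteq> 0"
  shows "map (\<lambda>x. inverse q * x * q) w \<in> conj_sphere u"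
proof -
  obtain r where r: "r \<noteq> 0" "w = map (\<lambda>p. r * p * inverse r) u"
    using assms(1) by (auto simp: conj_sphere_def)
  have "map (\<lambda>x. inverse q * x * q) w
      = map (\<lambda>p. (inverse q * r) * p * inverse (inverse q * r)) u"
    using r assms(2) by (simp add: nonzero_inverse_mult_distrib mult.assoc)
  moreover have "inverse q * r \<noteq> 0" using r assms(2) by simp
  ultimately show ?thesis unfolding conj_sphere_def by blast
qed

text \<open>
  The induction hypothesis is applied while the first block of \<open>vs\<close> is unmoved, and that block then
  takes the place of \<open>u\<close>: the condition on consecutive blocks concerns the original entries and may
  fail for the moved ones.
\<close>

lemma zero_locus_conj_blocks:
  assumes "left_ideal n I" and "u \<noteq> []" and "central_presentation (u @ concat vs) (u # vs)"
    and "u' @ u @ concat vs \<in> zero_locus n I"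
    and "list_all2 (\<lambda>w u. w \<in> conj_sphere u) ws vs"
  shows "u' @ u @ concat ws \<in> zero_locus n I"
  using assms(2-)
proof (induction vs arbitrary: u u' ws)
  case Nil
  then show ?case by simp
next
  case (Cons w vs)
  from Cons.prems(2) have nc: "\<not> commuting (last u # w)"
    and pres: "central_presentation (w @ concat vs) (w # vs)"
    by (auto simp: central_presentation_Cons_Cons)
  then have "w \<noteq> []" "commuting w" by (auto simp: central_presentation_def)
  obtain q ws' where q: "q \<noteq> 0" and ws: "ws = map (\<lambda>p. q * p * inverse q) w # ws'"
    and ws': "list_all2 (\<lambda>w u. w \<in> conj_sphere u) ws' vs"
    using Cons.prems(4) by (auto simp: list_all2_Cons2 conj_sphere_def)
  \<comment> \<open>Turning \<open>w\<close> by \<open>q\<close> will turn these blocks into \<open>ws'\<close>.\<close>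
  define zs where "zs = map (map (\<lambda>x. inverse q * x * q)) ws'"
  have "list_all2 (\<lambda>w u. w \<in> conj_sphere u) zs vs"
    using ws' q unfolding zs_def list_all2_map1
    by (auto elim!: list_all2_mono intro: conj_sphere_closed)
  then have "(u' @ u) @ w @ concat zs \<in> zero_locus n I"
    using Cons.prems(3) \<open>w \<noteq> []\<close> pres by (intro Cons.IH[of w "u' @ u" zs]) simp_all
  then have "(u' @ u) @ map (\<lambda>x. q * x * inverse q) (w @ concat zs) \<in> zero_locus n I"
    using Cons.prems(1) nc q \<open>commuting w\<close>
    by (intro zero_locus_conj_tail[OF assms(1)]) simp_all
  moreover have "map (\<lambda>x. q * x * inverse q) (concat zs) = concat ws'"
    unfolding zs_def map_concat[symmetric] using q by (rule map_conj_inverse_conj)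
  ultimately show ?case by (simp add: ws)
qed

theorem theorem1p3:
  fixes n :: nat and I :: "quat_mpoly set" and v :: "quat list"
  assumes "n \<ge> 1"
    and "left_ideal n I"
    and "v \<in> zero_locus n I"
  shows "enveloping_multisphere v \<subseteq> zero_locus n I"
proof
  fix b
  assume "b \<in> enveloping_multisphere v"
  then obtain ws where b: "b = hd (the_central_presentation v) @ concat ws"
    and ws: "list_all2 (\<lambda>w u. w \<in> conj_sphere u) ws (tl (the_central_presentation v))"
    by (auto simp: enveloping_multisphere_def)
  have "v \<noteq> []" using assms by (auto simp: zero_locus_def)
  then have pres: "central_presentation v (the_central_presentation v)"
    unfolding the_central_presentation_def by (rule theI'[OF central_presentation_ex1])
  then obtain u vs where vs: "the_central_presentation v = u # vs"
    by (cases "the_central_presentation v") (auto simp: central_presentation_def)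
  then have v: "v = u @ concat vs" and "u \<noteq> []"
    using pres by (auto simp: central_presentation_def)
  have "[] @ u @ concat ws \<in> zero_locus n I"
  proof (rule zero_locus_conj_blocks[OF assms(2) \<open>u \<noteq> []\<close>])
    show "central_presentation (u @ concat vs) (u # vs)" using pres by (simp add: vs v[symmetric])
    show "[] @ u @ concat vs \<in> zero_locus n I" using assms(3) by (simp add: v[symmetric])
    show "list_all2 (\<lambda>w u. w \<in> conj_sphere u) ws vs" using ws by (simp add: vs)
  qed
  then show "b \<in> zero_locus n I" by (simp add: b vs)
qed

end
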